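(* Let $\alpha\ge1$ be a countable ordinal, $K$ a separable metric space, $f:K\to\mathbb C$, and $(f_j)$ a uniformly bounded sequence of complex-valued continuous functions on $K$ with $f_j\to f$ pointwise. Let $x\in K$ and assume $0<\lambda<\infty$, where $\lambda=v_\alpha(\operatorname{Re}f)(x)$; let $0<\eta<1$. Then there exists a subsequence $(b_j)$ of $(f_j)$ such that, setting $e_1=b_1$ and $e_j=b_j-b_{j-1}$ for all $j>1$, for every infinite sequence of indices $1=m_1<m_2<\cdots$ there exist a point $t\in K$ and a positive integer $k$ with (1) $\sum_{j=1}^k\operatorname{Re}e_{m_{2j}}(t)>(1-\eta)\lambda$; (2) $\operatorname{Re}e_{m_{2j}}(t)>0$ for all $1\le j\le k$; (3) $\sum_{i\notin\{m_1,m_2,\dots\}}|e_i(t)|<\eta\lambda$.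
   Context: All upper limits are non-exclusive: $\overline{\lim}_{y\to x}g(y)=\inf_V\sup_{y\in V}g(y)$, the infimum over all open neighborhoods $V$ of $x$. For an extended real-valued function $g$ on $K$, $Ug(x)=\overline{\lim}_{y\to x}g(y)$ is its upper semi-continuous envelope. For $\varphi:K\to\mathbb R$, the positive oscillations $v_\alpha(\varphi)$ are defined by induction over countable ordinals: $v_0\varphi\equiv0$. If $\beta=\alpha+1$, $\tilde v_\beta\varphi(x)=\overline{\lim}_{y\to x}\bigl(\varphi(y)-\varphi(x)+v_\alpha\varphi(y)\bigr)$ for all $x\in K$. If $\beta$ is a limit ordinal, $\tilde v_\beta\varphi(x)=\sup_{\alpha<\beta}v_\alpha\varphi(x)$ for all $x\in K$. In both cases $v_\beta\varphi=U\tilde v_\beta\varphi$. These are $[0,\infty]$-valued functions. *)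

theory Defs
  imports "HOL-Analysis.Analysis"
begin

text \<open>Countable ordinals: order types of well-orders on sets of natural numbers.\<close>

quotient_type countable_ordinal = "nat rel" / partial: "\<lambda>r s. (r, s) \<in> ordIso"
proof (rule part_equivpI)
  have "Well_order ({} :: nat rel)"
    by (simp add: well_order_on_empty)
  then show "\<exists>r :: nat rel. (r, r) \<in> ordIso"
    using ordIso_reflexive by blast
  show "symp (\<lambda>r s :: nat rel. (r, s) \<in> ordIso)"
    by (auto intro: sympI ordIso_symmetric)
  show "transp (\<lambda>r s :: nat rel. (r, s) \<in> ordIso)"
    by (auto intro: transpI ordIso_transitive)
qed

instantiation countable_ordinal :: "{zero, one, ord}"
begin

lift_definition zero_countable_ordinal :: countable_ordinal is "{}"
  by (rule ordIso_reflexive) (simp add: well_order_on_empty)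

lift_definition one_countable_ordinal :: countable_ordinal is "{(0, 0)}"
  by (rule ordIso_reflexive)
    (auto simp: order_on_defs refl_on_def trans_def antisym_def total_on_def wf_def Field_def)

lift_definition less_eq_countable_ordinal ::
  "countable_ordinal \<Rightarrow> countable_ordinal \<Rightarrow> bool" is "\<lambda>r s. (r, s) \<in> ordLeq"
  by (meson ordIso_ordLeq_trans ordIso_symmetric ordLeq_ordIso_trans)

lift_definition less_countable_ordinal ::
  "countable_ordinal \<Rightarrow> countable_ordinal \<Rightarrow> bool" is "\<lambda>r s. (r, s) \<in> ordLess"
  by (meson ordIso_ordLess_trans ordIso_symmetric ordLess_ordIso_trans)

instance ..

end

lemma ordIso_self_Well_order: "(r, r) \<in> ordIso \<longleftrightarrow> Well_order r"
  using ordIso_reflexive by (auto simp: ordIso_def)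

instance countable_ordinal :: wellorder
proof
  fix a b c :: countable_ordinal
  show "a < b \<longleftrightarrow> a \<le> b \<and> \<not> b \<le> a"
    by transfer
      (metis not_ordLess_ordLeq not_ordLeq_iff_ordLess ordIso_self_Well_order ordLess_imp_ordLeq)
  show "a \<le> a"
    by transfer (simp add: ordIso_self_Well_order ordLeq_reflexive)
  show "a \<le> c" if "a \<le> b" "b \<le> c"
    using that by transfer (rule ordLeq_transitive)
  show "a = b" if "a \<le> b" "b \<le> a"
    using that by transfer (simp add: ordIso_iff_ordLeq)
  show "a \<le> b \<or> b \<le> a"
    by transfer (simp add: ordIso_self_Well_order ordLeq_total)
next
  fix P :: "countable_ordinal \<Rightarrow> bool" and a
  assume step: "\<And>x. (\<And>y. y < x \<Longrightarrow> P y) \<Longrightarrow> P x"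
  have "\<forall>a. r = rep_countable_ordinal a \<longrightarrow> P a" for r
  proof (induction r rule: wf_induct_rule[OF wf_ordLess])
    case (1 r)
    have "P y" if "y < a" "r = rep_countable_ordinal a" for a y
    proof -
      have "(rep_countable_ordinal y, rep_countable_ordinal a) \<in> ordLess"
        using \<open>y < a\<close> by (simp add: less_countable_ordinal.rep_eq)
      then show ?thesis
        using 1 that by blast
    qed
    then show ?case
      using step by blast
  qed
  then show "P a"
    by blast
qed

lemma zero_le_countable_ordinal: "0 \<le> (\<alpha> :: countable_ordinal)"
proof transfer
  fix r :: "nat rel"
  assume "(r, r) \<in> ordIso"
  then have r: "Well_order r"
    by (simp add: ordIso_self_Well_order)
  have empty: "Well_order ({} :: nat rel)"
    by (simp add: well_order_on_empty)
  have "(r, {} :: nat rel) \<notin> ordLess"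
    using ordLess_iff_ordIso_Restr[OF empty r] by simp
  then show "({} :: nat rel, r) \<in> ordLeq"
    using not_ordLess_iff_ordLeq[OF empty r] by blast
qed

text \<open>\<open>is_successor \<beta> \<alpha>\<close> means \<open>\<beta> = \<alpha> + 1\<close>; \<open>\<alpha>\<close> is determined by \<open>\<beta>\<close>.\<close>

definition is_successor :: "'o::wellorder \<Rightarrow> 'o \<Rightarrow> bool" where
  "is_successor \<beta> \<alpha> \<longleftrightarrow> \<alpha> < \<beta> \<and> (\<forall>\<gamma><\<beta>. \<gamma> \<le> \<alpha>)"

lemma is_successor_unique: "is_successor \<beta> \<alpha> \<Longrightarrow> is_successor \<beta> \<alpha>' \<Longrightarrow> \<alpha>' = \<alpha>"
  unfolding is_successor_def by (meson order.antisym)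

lemma the_successor [simp]: "is_successor \<beta> \<alpha> \<Longrightarrow> (THE \<alpha>. is_successor \<beta> \<alpha>) = \<alpha>"
  using is_successor_unique by blast

text \<open>Upper limits are non-exclusive: the point itself is not removed from the neighbourhoods.\<close>

definition upper_limit :: "('a::topological_space \<Rightarrow> ereal) \<Rightarrow> 'a \<Rightarrow> ereal" where
  "upper_limit g x = (INF V \<in> {V. open V \<and> x \<in> V}. SUP y \<in> V. g y)"

lemma upper_limit_eq_Limsup: "upper_limit g x = Limsup (nhds x) g"
proof (rule antisym)
  show "upper_limit g x \<le> Limsup (nhds x) g"
    unfolding upper_limit_def Limsup_def
  proof (rule INF_greatest)
    fix P assume "P \<in> {P. eventually P (nhds x)}"
    then obtain V where V: "open V" "x \<in> V" "\<And>y. y \<in> V \<Longrightarrow> P y"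
      by (auto simp: eventually_nhds)
    show "(INF V \<in> {V. open V \<and> x \<in> V}. SUP y \<in> V. g y) \<le> (SUP y \<in> Collect P. g y)"
      by (rule INF_lower2[of V]) (use V in \<open>auto intro!: SUP_subset_mono\<close>)
  qed
  show "Limsup (nhds x) g \<le> upper_limit g x"
    unfolding upper_limit_def Limsup_def
    by (rule INF_greatest, rule INF_lower2[where i = "\<lambda>y. y \<in> V" for V])
      (auto simp: eventually_nhds)
qed

definition usc_envelope :: "('a::topological_space \<Rightarrow> ereal) \<Rightarrow> 'a \<Rightarrow> ereal" where
  "usc_envelope g = (\<lambda>x. upper_limit g x)"

text \<open>The positive oscillations \<open>v\<^sub>\<beta>\<phi>\<close>, for all countable \<open>\<beta>\<close>; the usual recursion clauses are
  \<open>pos_osc_0\<close>, \<open>pos_osc_successor\<close> and \<open>pos_osc_limit\<close> below.\<close>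

function pos_osc ::
  "('a::topological_space \<Rightarrow> real) \<Rightarrow> countable_ordinal \<Rightarrow> 'a \<Rightarrow> ereal" where
  "pos_osc \<phi> \<beta> =
     (if \<beta> = 0 then (\<lambda>x. 0)
      else usc_envelope
        (if \<exists>\<alpha>. is_successor \<beta> \<alpha>
         then (\<lambda>x. upper_limit
           (\<lambda>y. ereal (\<phi> y - \<phi> x) + pos_osc \<phi> (THE \<alpha>. is_successor \<beta> \<alpha>) y) x)
         else (\<lambda>x. SUP \<alpha> \<in> {..<\<beta>}. pos_osc \<phi> \<alpha> x)))"
  by pat_completeness auto
termination
proof (relation "inv_image {(\<alpha>, \<beta>). \<alpha> < \<beta>} snd")
  show "wf (inv_image {(\<alpha> :: countable_ordinal, \<beta>). \<alpha> < \<beta>} snd)"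
    by (intro wf_inv_image wf)
next
  fix \<phi> :: "'a \<Rightarrow> real" and \<beta> :: countable_ordinal
  assume "\<exists>\<alpha>. is_successor \<beta> \<alpha>"
  then have "is_successor \<beta> (THE \<alpha>. is_successor \<beta> \<alpha>)"
    by auto
  then show "((\<phi>, THE \<alpha>. is_successor \<beta> \<alpha>), \<phi>, \<beta>) \<in> inv_image {(\<alpha>, \<beta>). \<alpha> < \<beta>} snd"
    by (simp add: is_successor_def)
qed auto

declare pos_osc.simps [simp del]

lemma pos_osc_0: "pos_osc \<phi> 0 = (\<lambda>x. 0)"
  by (simp add: pos_osc.simps)

lemma pos_osc_successor:
  assumes "is_successor \<beta> \<alpha>"
  shows "pos_osc \<phi> \<beta> =
    usc_envelope (\<lambda>x. upper_limit (\<lambda>y. ereal (\<phi> y - \<phi> x) + pos_osc \<phi> \<alpha> y) x)"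
proof -
  have "\<beta> \<noteq> 0"
    using assms zero_le_countable_ordinal[of \<alpha>] by (auto simp: is_successor_def)
  then show ?thesis
    using assms by (subst pos_osc.simps) auto
qed

lemma pos_osc_limit:
  assumes "\<beta> \<noteq> 0" "\<nexists>\<alpha>. is_successor \<beta> \<alpha>"
  shows "pos_osc \<phi> \<beta> = usc_envelope (\<lambda>x. SUP \<alpha> \<in> {..<\<beta>}. pos_osc \<phi> \<alpha> x)"
  using assms by (subst pos_osc.simps) auto

text \<open>Sequences are indexed from \<open>1\<close> on; the value at index \<open>0\<close> carries no meaning.\<close>

definition difference_sequence :: "(nat \<Rightarrow> 'a \<Rightarrow> complex) \<Rightarrow> nat \<Rightarrow> 'a \<Rightarrow> complex" where
  "difference_sequence b j t = (if j = 1 then b 1 t else b j t - b (j - 1) t)"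

end

theory Submission
  imports Defs
begin

text \<open>Put \<open>\<phi> = Re f\<close>. If \<open>v\<^sub>\<alpha> \<phi>(x) > r \<ge> 0\<close> then arbitrarily close to \<open>x\<close> there is a base point \<open>z\<close>
  such that, for some \<open>\<beta> < \<alpha>\<close>, arbitrarily close to \<open>z\<close> there are points \<open>y\<close> with a rise
  \<open>\<delta> = \<phi>(y) - \<phi>(z)\<close> bounded below by a positive number that depends only on \<open>z\<close> and with
  either \<open>\<delta> > r\<close> or \<open>v\<^sub>\<beta> \<phi>(y) > r - \<delta>\<close>. Iterating, one obtains chains
  \<open>z\<^sub>1, y\<^sub>1, z\<^sub>2, y\<^sub>2, \<dots>, y\<^sub>k\<close>, finite because the ordinals decrease, whose rises add up to more
  than \<open>r\<close>, and in which every point may be taken as close to the previous one as desired.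

  The subsequence is chosen diagonally together with increasing finite sets \<open>P\<^sub>j\<close> of points:
  \<open>b\<^sub>j\<close> and all later functions are within \<open>\<epsilon>\<^sub>j\<close> of \<open>f\<close> on \<open>P\<^sub>j\<close>, and then \<open>P\<^bsub>j+1\<^esub>\<close> receives a successor
  of each point of \<open>P\<^sub>j\<close>, so close to it that \<open>b\<^sub>1, \<dots>, b\<^sub>j\<close> barely change. Given \<open>m\<close>, move along a
  chain at the times \<open>m\<^sub>2, m\<^sub>3, \<dots>\<close>; at its last point \<open>t\<close> the function \<open>b\<^sub>j\<close> is close to the value
  of \<open>f\<close> at the chain point current at time \<open>j\<close>. Hence \<open>e\<^sub>i(t)\<close> is negligible unless \<open>i\<close> is some
  \<open>m\<^sub>l\<close>, and \<open>Re e\<^sub>i(t)\<close> is nearly a rise when \<open>i = m\<^bsub>2j\<^esub>\<close>.\<close>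

section \<open>Rises of a function detected by its positive oscillations\<close>

lemma upper_limit_gtD:
  assumes "r < upper_limit g x" "open V" "x \<in> V"
  obtains y where "y \<in> V" "r < g y"
proof -
  have "upper_limit g x \<le> (SUP y\<in>V. g y)"
    unfolding upper_limit_def using assms by (auto intro: INF_lower)
  then have "r < (SUP y\<in>V. g y)"
    using assms(1) by (rule less_le_trans[rotated])
  then show ?thesis
    using that by (auto simp: less_SUP_iff)
qed

text \<open>\<open>c\<close> is fixed before the neighbourhood \<open>W\<close>, so it can serve as
  a tolerance before the next point is chosen.\<close>

definition rises :: "('a::topological_space \<Rightarrow> real) \<Rightarrow> 'a \<Rightarrow> real \<Rightarrow> countable_ordinal \<Rightarrow> real \<Rightarrow> bool"
  where "rises \<phi> x r \<alpha> c \<longleftrightarrow> (\<forall>W. open W \<and> x \<in> W \<longrightarrow>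
    (\<exists>y\<in>W. c < \<phi> y - \<phi> x \<and>
      (r < \<phi> y - \<phi> x \<or> ereal (r - (\<phi> y - \<phi> x)) < pos_osc \<phi> \<alpha> y)))"

text \<open>Induction on \<open>\<alpha>\<close> with \<open>V\<close> kept. At a limit, a smaller
  ordinal already exceeds \<open>r\<close> at some point of \<open>V\<close>. At a successor, either
  the preceding oscillation exceeds \<open>r\<close> somewhere in \<open>V\<close>, or the
  increments of \<open>\<phi>\<close> supply the rises.\<close>

lemma pos_osc_descent:
  assumes "ereal r < pos_osc \<phi> \<alpha> x" "0 \<le> r" "open V" "x \<in> V"
  shows "\<exists>y\<in>V. \<exists>\<beta><\<alpha>. \<exists>c>0. rises \<phi> y r \<beta> c"
  using assms
proof (induction \<alpha> arbitrary: x rule: less_induct)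
  case (less \<alpha>)
  have lower: ?case if "y \<in> V" "\<beta> < \<alpha>" "ereal r < pos_osc \<phi> \<beta> y" for y \<beta>
    using less.IH[of \<beta> y] that less.prems by (meson less_trans)
  have "\<alpha> \<noteq> 0"
    using less.prems by (auto simp: pos_osc_0)
  show ?case
  proof (cases "\<exists>\<beta>. is_successor \<alpha> \<beta>")
    case False
    then have "ereal r < upper_limit (\<lambda>x. SUP \<beta>\<in>{..<\<alpha>}. pos_osc \<phi> \<beta> x) x"
      using less.prems(1) \<open>\<alpha> \<noteq> 0\<close> by (simp add: pos_osc_limit usc_envelope_def)
    then obtain y where "y \<in> V" "ereal r < (SUP \<beta>\<in>{..<\<alpha>}. pos_osc \<phi> \<beta> y)"
      using less.prems by (elim upper_limit_gtD)
    then show ?thesis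
      using lower by (auto simp: less_SUP_iff)
  next
    case True
    then obtain \<beta> where succ: "is_successor \<alpha> \<beta>"
      by blast
    then have "\<beta> < \<alpha>"
      by (simp add: is_successor_def)
    \<comment> \<open>If \<open>v\<^sub>\<beta> \<phi> \<le> r\<close> on \<open>V\<close>, then rises inside \<open>V\<close> are at least \<open>r' - r\<close>: this is the uniform lower bound.\<close>
    show ?thesis
    proof (cases "\<exists>y\<in>V. ereal r < pos_osc \<phi> \<beta> y")
      case True
      then show ?thesis
        using lower \<open>\<beta> < \<alpha>\<close> by blast
    next
      case False
      obtain z where z: "z \<in> V"
        "ereal r < upper_limit (\<lambda>y. ereal (\<phi> y - \<phi> z) + pos_osc \<phi> \<beta> y) z"
        using less.prems(1)[unfolded pos_osc_successor[OF succ] usc_envelope_def] less.prems(3,4)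
        by (rule upper_limit_gtD)
      then obtain r' where r': "r < r'"
        "ereal r' < upper_limit (\<lambda>y. ereal (\<phi> y - \<phi> z) + pos_osc \<phi> \<beta> y) z"
        using ereal_dense2 by fastforce
      have "\<exists>y\<in>W. r' - r < \<phi> y - \<phi> z \<and>
          (r < \<phi> y - \<phi> z \<or> ereal (r - (\<phi> y - \<phi> z)) < pos_osc \<phi> \<beta> y)"
        if W: "open W" "z \<in> W" for W
      proof -
        obtain y where y: "y \<in> W \<inter> V" "ereal r' < ereal (\<phi> y - \<phi> z) + pos_osc \<phi> \<beta> y"
          using upper_limit_gtD[OF r'(2), of "W \<inter> V"] W z(1) less.prems(3) by blast
        moreover have "pos_osc \<phi> \<beta> y \<le> ereal r"
          using False y by force
        ultimately show ?thesis
          using r' by (cases "pos_osc \<phi> \<beta> y") (auto intro!: bexI[of _ y])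
      qed
      then have "rises \<phi> z r \<beta> (r' - r)"
        by (auto simp: rises_def)
      then show ?thesis
        using z \<open>\<beta> < \<alpha>\<close> r' by (intro bexI[of _ z] exI[of _ \<beta>] conjI exI[of _ "r' - r"]) auto
    qed
  qed
qed

section \<open>Diagonal choice of the subsequence\<close>

lemma strict_mono_on_ge_self:
  fixes m :: "nat \<Rightarrow> nat"
  assumes "strict_mono_on {1..} m" "1 \<le> i" "1 \<le> m 1"
  shows "i \<le> m i"
  using assms(2)
proof (induction i rule: dec_induct)
  case (step i)
  then have "m i < m (Suc i)"
    using assms(1) by (auto simp: strict_mono_on_def)
  with step show ?case by simp
qed (use assms in simp)

text \<open>The diagonal construction for an abstract game: moves are well-founded and, outside
  \<open>T\<close>, can land in any neighbourhood of the current point. \<open>\<sigma>\<close> is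
  fixed before \<open>m\<close>; the run answers \<open>m\<close>, and \<open>st i\<close> becomes
  current at time \<open>m i\<close>.\<close>

lemma approximating_subsequence:
  fixes F :: "nat \<Rightarrow> 'a::topological_space \<Rightarrow> 'b::metric_space" and p :: "'s \<Rightarrow> 'a"
  assumes cont: "\<And>j. 1 \<le> j \<Longrightarrow> continuous_on UNIV (F j)"
    and lim: "\<And>t. (\<lambda>j. F j t) \<longlonglongrightarrow> f t"
    and wf: "wf {(s', s). step s s'}"
    and tol0: "0 < tol s0" and tol: "\<And>s s'. step s s' \<Longrightarrow> (0::real) < tol s'"
    and progress: "\<And>s W. s \<notin> T \<Longrightarrow> open W \<Longrightarrow> p s \<in> W \<Longrightarrow> \<exists>s'. step s s' \<and> p s' \<in> W"
    and "0 < E"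
  shows "\<exists>\<sigma>. strict_mono \<sigma> \<and> (\<forall>j. 1 \<le> \<sigma> j) \<and>
    (\<forall>m. strict_mono_on {1..} m \<and> 1 \<le> m 1 \<longrightarrow>
      (\<exists>n st. 1 \<le> n \<and> st 1 = s0 \<and> st n \<in> T \<and> (\<forall>i\<in>{1..<n}. step (st i) (st (Suc i))) \<and>
        (\<forall>i\<in>{1..n}. \<forall>j\<ge>m i. (i < n \<longrightarrow> j < m (Suc i)) \<longrightarrow>
          dist (F (\<sigma> j) (p (st n))) (f (p (st i))) \<le> min (E / 2 ^ j) (tol (st i)))))"
proof -
  \<comment> \<open>In \<open>3 * \<epsilon>\<close>, one \<open>\<epsilon>\<close> pays for
    convergence at the current point and two for the drift to the final point of a run.\<close>
  define inv where "inv = (\<lambda>(P, k, \<epsilon>). finite P \<and> s0 \<in> P \<and> 1 \<le> k \<and> 0 < \<epsilon> \<and>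
    (\<forall>s\<in>P. 3 * \<epsilon> \<le> tol s \<and> (\<forall>i\<ge>k. dist (F i (p s)) (f (p s)) < \<epsilon>)))"
  \<comment> \<open>Halving keeps the total drift over later moves within
    \<open>2 * \<epsilon>\<close>, since
    \<open>\<epsilon> + 2 * \<epsilon>' \<le> 2 * \<epsilon>\<close>.\<close>
  define ext where "ext = (\<lambda>(P, k, \<epsilon>) (P', k', \<epsilon>'). k < k' \<and> 2 * \<epsilon>' \<le> \<epsilon> \<and> P \<subseteq> P' \<and>
    (\<forall>s\<in>P - T. \<exists>s'\<in>P'. step s s' \<and> (\<forall>i\<in>{1..k}. dist (F i (p s')) (F i (p s)) < \<epsilon>)))"
  have complete: "\<exists>k \<epsilon>. inv (P, k, \<epsilon>) \<and> N < k \<and> \<epsilon> \<le> \<delta>"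
    if P: "finite P" "s0 \<in> P" "\<And>s. s \<in> P \<Longrightarrow> 0 < tol s" and "0 < \<delta>" for P N \<delta>
  proof -
    define \<epsilon> where "\<epsilon> = Min (insert \<delta> ((\<lambda>s. tol s / 3) ` P))"
    have \<epsilon>: "0 < \<epsilon>" "\<epsilon> \<le> \<delta>" "\<And>s. s \<in> P \<Longrightarrow> 3 * \<epsilon> \<le> tol s"
    proof -
      show "0 < \<epsilon>" "\<epsilon> \<le> \<delta>"
        using P \<open>0 < \<delta>\<close> by (auto simp: \<epsilon>_def)
      show "3 * \<epsilon> \<le> tol s" if "s \<in> P" for s
      proof -
        have "\<epsilon> \<le> tol s / 3"
          unfolding \<epsilon>_def using P that by (intro Min_le) auto
        then show ?thesis by simp
      qed
    qed
    have "\<forall>\<^sub>F i in sequentially. \<forall>s\<in>P. dist (F i (p s)) (f (p s)) < \<epsilon>"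
      using P \<epsilon> lim by (intro eventually_ball_finite ballI tendstoD) auto
    then obtain M where "\<And>i s. M \<le> i \<Longrightarrow> s \<in> P \<Longrightarrow> dist (F i (p s)) (f (p s)) < \<epsilon>"
      by (auto simp: eventually_sequentially)
    then have "inv (P, max M (Suc N), \<epsilon>)"
      using P \<epsilon> by (auto simp: inv_def)
    then show ?thesis
      using \<epsilon> by (intro exI[of _ "max M (Suc N)"] exI[of _ \<epsilon>]) auto
  qed
  have "\<exists>X. \<forall>n. inv (X n) \<and> (n = 0 \<longrightarrow> 3 * snd (snd (X n)) \<le> E) \<and> ext (X n) (X (Suc n))"
  proof (rule dependent_nat_choice[where Q = "\<lambda>_. ext" and
        P = "\<lambda>n X. inv X \<and> (n = 0 \<longrightarrow> 3 * snd (snd X) \<le> E)", simplified conj_assoc])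
    obtain k \<epsilon> where "inv ({s0}, k, \<epsilon>)" "\<epsilon> \<le> E / 3"
      using complete[of "{s0}" "E / 3" 0] tol0 \<open>0 < E\<close> by auto
    then show "\<exists>X. inv X \<and> ((0::nat) = 0 \<longrightarrow> 3 * snd (snd X) \<le> E)"
      by (intro exI[of _ "({s0}, k, \<epsilon>)"]) auto
  next
    fix X and n :: nat
    assume X: "inv X \<and> (n = 0 \<longrightarrow> 3 * snd (snd X) \<le> E)"
    obtain P k \<epsilon> where [simp]: "X = (P, k, \<epsilon>)"
      by (cases X)
    have "\<exists>s'. step s s' \<and> (\<forall>i\<in>{1..k}. dist (F i (p s')) (F i (p s)) < \<epsilon>)" if s: "s \<in> P - T" for s
    proof -
      define W where "W = (\<Inter>i\<in>{1..k}. F i -` ball (F i (p s)) \<epsilon>)"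
      have "open W"
        unfolding W_def using cont by (intro open_INT ballI open_vimage) auto
      moreover have "p s \<in> W"
        using X by (auto simp: W_def inv_def)
      ultimately obtain s' where "step s s'" "p s' \<in> W"
        using progress s by blast
      then show ?thesis
        by (auto simp: W_def dist_commute)
    qed
    then obtain g where g: "\<And>s. s \<in> P - T \<Longrightarrow> step s (g s)"
      "\<And>s i. s \<in> P - T \<Longrightarrow> i \<in> {1..k} \<Longrightarrow> dist (F i (p (g s))) (F i (p s)) < \<epsilon>"
      by metis
    have "0 < tol s" if "s \<in> P" for s
      using X that by (fastforce simp: inv_def)
    then have "0 < tol s" if "s \<in> P \<union> g ` (P - T)" for s
      using that g(1) tol by auto
    moreover have "finite P" "s0 \<in> P" "0 < \<epsilon>"
      using X by (auto simp: inv_def)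
    ultimately obtain k' \<epsilon>' where "inv (P \<union> g ` (P - T), k', \<epsilon>')" "k < k'" "\<epsilon>' \<le> \<epsilon> / 2"
      using complete[of "P \<union> g ` (P - T)" "\<epsilon> / 2" k] by auto
    then show "\<exists>Y. inv Y \<and> (Suc n = 0 \<longrightarrow> 3 * snd (snd Y) \<le> E) \<and> ext X Y"
      using g by (intro exI[of _ "(P \<union> g ` (P - T), k', \<epsilon>')"])
        (auto simp: ext_def intro!: bexI[where x = "g s" for s])
  qed
  then obtain X where X: "\<And>n. inv (X n)" "3 * snd (snd (X 0)) \<le> E" "\<And>n. ext (X n) (X (Suc n))"
    by blast
  define P \<sigma> \<epsilon> where "P n = fst (X n)" and "\<sigma> n = fst (snd (X n))" and "\<epsilon> n = snd (snd (X n))" for n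
  have Xeq: "X n = (P n, \<sigma> n, \<epsilon> n)" for n
    by (simp add: P_def \<sigma>_def \<epsilon>_def)
  have inv: "s0 \<in> P n" "1 \<le> \<sigma> n" "0 < \<epsilon> n" "\<And>s. s \<in> P n \<Longrightarrow> 3 * \<epsilon> n \<le> tol s"
    "\<And>s i. s \<in> P n \<Longrightarrow> \<sigma> n \<le> i \<Longrightarrow> dist (F i (p s)) (f (p s)) < \<epsilon> n" for n
    using X(1)[of n] by (auto simp: inv_def Xeq)
  have ext: "\<sigma> n < \<sigma> (Suc n)" "2 * \<epsilon> (Suc n) \<le> \<epsilon> n" "P n \<subseteq> P (Suc n)"
    "\<And>s. s \<in> P n \<Longrightarrow> s \<notin> T \<Longrightarrow>
      \<exists>s'\<in>P (Suc n). step s s' \<and> (\<forall>i\<in>{1..\<sigma> n}. dist (F i (p s')) (F i (p s)) < \<epsilon> n)" for n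
    using X(3)[of n] by (auto simp: ext_def Xeq)
  have \<sigma>_mono: "strict_mono \<sigma>"
    using ext(1) by (simp add: strict_mono_Suc_iff)
  have P_mono: "P i \<subseteq> P j" if "i \<le> j" for i j
    using ext(3) that by (rule lift_Suc_mono_le)
  have "\<epsilon> (Suc n) \<le> \<epsilon> n" for n
    using ext(2)[of n] inv(3)[of "Suc n"] by linarith
  then have \<epsilon>_mono: "\<epsilon> j \<le> \<epsilon> i" if "i \<le> j" for i j
    using that by (rule lift_Suc_antimono_le)
  have \<epsilon>_bound: "3 * \<epsilon> n \<le> E / 2 ^ n" for n
  proof (induction n)
    case 0
    then show ?case using X(2) by (simp add: \<epsilon>_def)
  next
    case (Suc n)
    then show ?case using ext(2)[of n] by simp
  qed
  \<comment> \<open>Runs may start at any \<open>l\<close>, so that the induction on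
    \<open>s\<close> can pass to \<open>Suc l\<close>. The drift bound also covers times before
    \<open>m l\<close>, because the preceding move needs it there.\<close>
  have chain: "\<exists>n st. l \<le> n \<and> st l = s \<and> st n \<in> T \<and> (\<forall>i\<in>{l..<n}. step (st i) (st (Suc i))) \<and>
      (\<forall>j<m (Suc l). dist (F (\<sigma> j) (p (st n))) (F (\<sigma> j) (p s)) \<le> 2 * \<epsilon> (m (Suc l) - 1)) \<and>
      (\<forall>i\<in>{l..n}. \<forall>j\<ge>m i. (i < n \<longrightarrow> j < m (Suc i)) \<longrightarrow>
        dist (F (\<sigma> j) (p (st n))) (f (p (st i))) \<le> min (E / 2 ^ j) (tol (st i)))"
    if m: "strict_mono_on {1..} m" and "1 \<le> l" "s \<in> P (m l)" for m l s
    using that(2-)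
  proof (induction s arbitrary: l rule: wf_induct_rule[OF wf])
    case (1 s)
    have near: "dist (F (\<sigma> j) (p s)) (f (p s)) < \<epsilon> j" if "m l \<le> j" for j
      using inv(5)[of s j "\<sigma> j"] P_mono[OF that] 1 by auto
    have fine: "3 * \<epsilon> j \<le> min (E / 2 ^ j) (tol s)" if "m l \<le> j" for j
      using inv(4)[of s j] P_mono[OF that] 1 \<epsilon>_bound[of j] by auto
    show ?case
    proof (cases "s \<in> T")
      case True
      have "dist (F (\<sigma> j) (p s)) (f (p s)) \<le> min (E / 2 ^ j) (tol s)" if "m l \<le> j" for j
        using near[OF that] fine[OF that] inv(3)[of j] by linarith
      then show ?thesis
        using True inv(3) by (intro exI[of _ l] exI[of _ "\<lambda>_. s"]) (auto simp: less_imp_le)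
    next
      case False
      have m_Suc: "m l < m (Suc l)" "m (Suc l) < m (Suc (Suc l))"
        using m \<open>1 \<le> l\<close> by (auto simp: strict_mono_on_def)
      \<comment> \<open>The last time at which \<open>s\<close> is current: its successor enters at
        \<open>Suc h\<close>, so close that the functions selected up to time \<open>h\<close>
        change by less than \<open>\<epsilon> h\<close>.\<close>
      define h where "h = m (Suc l) - 1"
      have h: "Suc h = m (Suc l)" "m l \<le> h"
        using m_Suc by (auto simp: h_def)
      obtain s' where s': "s' \<in> P (m (Suc l))" "step s s'"
        "\<And>i. i \<in> {1..\<sigma> h} \<Longrightarrow> dist (F i (p s')) (F i (p s)) < \<epsilon> h"
        using ext(4)[of s h, unfolded h(1)] P_mono[OF h(2)] 1 False by blast
      have "1 \<le> Suc l" "(s', s) \<in> {(s', s). step s s'}"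
        using s'(2) by auto
      from 1(1)[OF this(2,1) s'(1)]
      obtain n st where IH: "Suc l \<le> n" "st (Suc l) = s'" "st n \<in> T"
        "\<forall>i\<in>{Suc l..<n}. step (st i) (st (Suc i))"
        "\<forall>j<m (Suc (Suc l)).
          dist (F (\<sigma> j) (p (st n))) (F (\<sigma> j) (p s')) \<le> 2 * \<epsilon> (m (Suc (Suc l)) - 1)"
        "\<forall>i\<in>{Suc l..n}. \<forall>j\<ge>m i. (i < n \<longrightarrow> j < m (Suc i)) \<longrightarrow>
          dist (F (\<sigma> j) (p (st n))) (f (p (st i))) \<le> min (E / 2 ^ j) (tol (st i))"
        by (elim exE conjE) (rule that)
      have close: "dist (F (\<sigma> j) (p (st n))) (F (\<sigma> j) (p s)) \<le> 2 * \<epsilon> h" if "j < m (Suc l)" for j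
      proof -
        have "\<sigma> j \<le> \<sigma> h"
          using that h \<sigma>_mono by (simp add: strict_mono_less_eq)
        then have "dist (F (\<sigma> j) (p s')) (F (\<sigma> j) (p s)) < \<epsilon> h"
          using s'(3) inv(2) by simp
        moreover have "2 * \<epsilon> (m (Suc (Suc l)) - 1) \<le> \<epsilon> h"
        proof -
          have "\<epsilon> (m (Suc (Suc l)) - 1) \<le> \<epsilon> (Suc h)"
            using h(1) m_Suc(2) by (intro \<epsilon>_mono) linarith
          then show ?thesis
            using ext(2)[of h] by linarith
        qed
        ultimately show ?thesis
          using IH(5)[rule_format, of j] that m_Suc
            dist_triangle[of "F (\<sigma> j) (p (st n))" "F (\<sigma> j) (p s)" "F (\<sigma> j) (p s')"] by simp
      qed
      have near_s: "dist (F (\<sigma> j) (p (st n))) (f (p s)) \<le> min (E / 2 ^ j) (tol s)"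
        if "m l \<le> j" "j < m (Suc l)" for j
      proof -
        have "\<epsilon> h \<le> \<epsilon> j"
          using that h by (intro \<epsilon>_mono) simp
        then show ?thesis
          using close[OF that(2)] near[OF that(1)] fine[OF that(1)]
            dist_triangle[of "F (\<sigma> j) (p (st n))" "f (p s)" "F (\<sigma> j) (p s)"] by linarith
      qed
      define st' where "st' = st(l := s)"
      have st': "st' l = s" "\<And>i. l < i \<Longrightarrow> st' i = st i"
        by (auto simp: st'_def)
      have "step (st' i) (st' (Suc i))" if "i \<in> {l..<n}" for i
        using that IH(2,4) s'(2) st' by (cases "i = l") auto
      moreover have "dist (F (\<sigma> j) (p (st' n))) (f (p (st' i))) \<le> min (E / 2 ^ j) (tol (st' i))"
        if "i \<in> {l..n}" "m i \<le> j" "i < n \<longrightarrow> j < m (Suc i)" for i j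
      proof (cases "i = l")
        case True
        then show ?thesis
          using that near_s[of j] IH(1) st' by auto
      next
        case False
        then show ?thesis
          using that IH(6)[rule_format, of i j] IH(1) st' by simp
      qed
      ultimately show ?thesis
        using IH(1,3) st' close
        by (intro exI[of _ n] exI[of _ st'] conjI ballI allI impI) (simp_all add: h_def)
    qed
  qed
  show ?thesis
  proof (intro exI[of _ \<sigma>] conjI allI impI)
    fix m :: "nat \<Rightarrow> nat"
    assume m: "strict_mono_on {1..} m \<and> 1 \<le> m 1"
    from chain[OF conjunct1[OF m] order_refl inv(1)]
    show "\<exists>n st. 1 \<le> n \<and> st 1 = s0 \<and> st n \<in> T \<and> (\<forall>i\<in>{1..<n}. step (st i) (st (Suc i))) \<and>
        (\<forall>i\<in>{1..n}. \<forall>j\<ge>m i. (i < n \<longrightarrow> j < m (Suc i)) \<longrightarrow>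
          dist (F (\<sigma> j) (p (st n))) (f (p (st i))) \<le> min (E / 2 ^ j) (tol (st i)))"
      by (elim exE conjE) (intro exI conjI)
  qed (use \<sigma>_mono inv in auto)
qed

section \<open>Climbing chains of base and jump points\<close>

text \<open>A jump point keeps the gap of its base point, as the tolerance at both ends of the rise.\<close>

datatype 'a state =
  Base (point: 'a) (target: real) (rank: countable_ordinal) (gap: real)
| Jump (point: 'a) (target: real) (rank: countable_ordinal) (gap: real)

text \<open>The rank of a base point is the ordinal left for the jump that follows. A jump with
  negative target ends the climb.\<close>

fun valid :: "('a::topological_space \<Rightarrow> real) \<Rightarrow> 'a state \<Rightarrow> bool" where
  "valid \<phi> (Base x r \<alpha> c) \<longleftrightarrow> 0 < c \<and> rises \<phi> x r \<alpha> c"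
| "valid \<phi> (Jump x r \<alpha> c) \<longleftrightarrow> 0 < c \<and> (r < 0 \<or> ereal r < pos_osc \<phi> \<alpha> x)"

text \<open>\<open>target\<close> is the height still to be gained. The rules contain no distances:
  closeness enters only through \<open>W\<close> in \<open>climb_progress\<close>.\<close>

inductive climb :: "('a::topological_space \<Rightarrow> real) \<Rightarrow> 'a state \<Rightarrow> 'a state \<Rightarrow> bool" for \<phi> where
  up: "climb \<phi> (Base x r \<alpha> c) (Jump y (r - (\<phi> y - \<phi> x)) \<alpha> c)"
    if "c < \<phi> y - \<phi> x" "valid \<phi> (Jump y (r - (\<phi> y - \<phi> x)) \<alpha> c)"
| descend: "climb \<phi> (Jump y r \<alpha> d) (Base x r \<beta> c)"
    if "\<beta> < \<alpha>" "valid \<phi> (Base x r \<beta> c)"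

text \<open>\<open>descend\<close> lowers the rank; \<open>up\<close> keeps it but lowers the second
  component.\<close>

lemma wf_climb: "wf {(s', s). climb \<phi> s s'}"
proof (rule wf_subset)
  show "wf (inv_image ({(\<alpha>, \<beta>). \<alpha> < \<beta>} <*lex*> less_than) (\<lambda>s. (rank s, if is_Base s then 1 else 0)))"
    by (intro wf_inv_image wf_lex_prod wf wf_less_than)
  show "{(s', s). climb \<phi> s s'} \<subseteq>
      inv_image ({(\<alpha>, \<beta>). \<alpha> < \<beta>} <*lex*> less_than) (\<lambda>s. (rank s, if is_Base s then 1 else 0))"
    by (auto elim!: climb.cases)
qed

lemma climb_valid: "climb \<phi> s s' \<Longrightarrow> valid \<phi> s'"
  by (auto elim: climb.cases)

lemma valid_gap_pos: "valid \<phi> s \<Longrightarrow> 0 < gap s"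
  by (cases s) auto

lemma climb_is_Base: "climb \<phi> s s' \<Longrightarrow> is_Base s' \<longleftrightarrow> \<not> is_Base s"
  by (auto elim: climb.cases)

lemma climb_Base:
  assumes "climb \<phi> s s'" "is_Base s"
  shows "gap s' = gap s" "gap s < \<phi> (point s') - \<phi> (point s)"
    "target s' = target s - (\<phi> (point s') - \<phi> (point s))"
  using assms by (auto elim: climb.cases)

lemma climb_Jump: "climb \<phi> s s' \<Longrightarrow> \<not> is_Base s \<Longrightarrow> target s' = target s"
  by (auto elim: climb.cases)

lemma climb_progress:
  assumes "valid \<phi> s" "\<not> (\<not> is_Base s \<and> target s < 0)" "open W" "point s \<in> W"
  shows "\<exists>s'. climb \<phi> s s' \<and> point s' \<in> W"
proof (cases s)
  case (Base x r \<alpha> c)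
  with assms obtain y where "y \<in> W" "c < \<phi> y - \<phi> x"
    "r < \<phi> y - \<phi> x \<or> ereal (r - (\<phi> y - \<phi> x)) < pos_osc \<phi> \<alpha> y"
    by (auto simp: rises_def)
  then have "climb \<phi> s (Jump y (r - (\<phi> y - \<phi> x)) \<alpha> c)"
    unfolding Base using assms(1) Base by (intro climb.up) auto
  with \<open>y \<in> W\<close> show ?thesis
    by (metis state.sel(2))
next
  case (Jump x r \<alpha> c)
  with assms obtain y \<beta> c' where "y \<in> W" "\<beta> < \<alpha>" "0 < c'" "rises \<phi> y r \<beta> c'"
    using pos_osc_descent[of r \<phi> \<alpha> x W] by auto
  then have "climb \<phi> s (Base y r \<beta> c')"
    unfolding Jump by (intro climb.descend) auto
  with \<open>y \<in> W\<close> show ?thesis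
    by (metis state.sel(1))
qed

text \<open>This parity is what matches the rises with the indices \<open>m (2 * j)\<close>.\<close>

lemma climb_chain:
  assumes "valid \<phi> (st 1)" "is_Base (st 1)" "\<And>i. i \<in> {1..<n} \<Longrightarrow> climb \<phi> (st i) (st (Suc i))"
    and "1 \<le> i" "i \<le> n"
  shows "valid \<phi> (st i) \<and> (is_Base (st i) \<longleftrightarrow> odd i)"
  using assms(4,5)
proof (induction i rule: dec_induct)
  case base
  then show ?case using assms(1,2) by simp
next
  case (step i)
  then have climb: "climb \<phi> (st i) (st (Suc i))" and "is_Base (st i) \<longleftrightarrow> odd i"
    using assms(3) by auto
  then show ?case
    using climb_valid[OF climb] climb_is_Base[OF climb] by simp
qed

text \<open>The target drops by the rise at each \<open>up\<close> and is kept by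
  \<open>descend\<close>. A negative final target thus means that the rises add up to more than the
  initial one.\<close>

lemma climb_chain_target:
  assumes "is_Base (st 1)" "\<And>i. i \<in> {1..<n} \<Longrightarrow> climb \<phi> (st i) (st (Suc i))"
    and "1 \<le> k" "2 * k \<le> n"
    and parity: "\<And>i. 1 \<le> i \<Longrightarrow> i \<le> n \<Longrightarrow> is_Base (st i) \<longleftrightarrow> odd i"
  shows "target (st (2 * k)) =
    target (st 1) - (\<Sum>j=1..k. \<phi> (point (st (2 * j))) - \<phi> (point (st (2 * j - 1))))"
  using assms(3,4)
proof (induction k rule: dec_induct)
  case base
  then show ?case
    using climb_Base(3)[OF assms(2)[of 1] assms(1)] by (simp add: numeral_2_eq_2)
next
  case (step k)
  have "target (st (Suc (2 * k))) = target (st (2 * k))"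
    using climb_Jump[OF assms(2)[of "2 * k"]] parity[of "2 * k"] step by simp
  moreover have "target (st (Suc (Suc (2 * k)))) = target (st (Suc (2 * k))) -
      (\<phi> (point (st (Suc (Suc (2 * k))))) - \<phi> (point (st (Suc (2 * k)))))"
    using climb_Base(3)[OF assms(2)[of "Suc (2 * k)"]] parity[of "Suc (2 * k)"] step by simp
  ultimately show ?case
    using step by simp
qed

text \<open>Finds the state of a run that is current at time \<open>i\<close>; the last one stays
  current forever.\<close>

lemma segment_exists:
  fixes m :: "nat \<Rightarrow> nat"
  assumes "1 \<le> n" "m 1 \<le> i"
  shows "\<exists>l\<in>{1..n}. m l \<le> i \<and> (l < n \<longrightarrow> i < m (Suc l))"
  using assms(1)
proof (induction n rule: dec_induct)
  case base
  then show ?case using assms by simp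
next
  case (step n)
  then obtain l where l: "l \<in> {1..n}" "m l \<le> i" "l < n \<longrightarrow> i < m (Suc l)"
    by blast
  show ?case
  proof (cases "m (Suc n) \<le> i")
    case True
    then show ?thesis by (intro bexI[of _ "Suc n"]) auto
  next
    case False
    then have "l < Suc n \<longrightarrow> i < m (Suc l)"
      using l by (cases "l = n") auto
    then show ?thesis using l by (intro bexI[of _ l]) auto
  qed
qed

text \<open>Summability is part of the conclusion because \<open>infsum\<close> is \<open>0\<close>
  by default on non-summable families.\<close>

lemma infsum_geometric_bound:
  fixes g :: "nat \<Rightarrow> real"
  assumes "\<And>i. i \<in> A \<Longrightarrow> 0 \<le> g i" "\<And>i. i \<in> A \<Longrightarrow> g i \<le> C / 2 ^ i" "0 \<le> C"
  shows "g summable_on A" "infsum g A \<le> 2 * C"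
proof -
  have geo: "(\<lambda>i. C / 2 ^ i) sums (2 * C)"
    using sums_mult[OF geometric_sums[of "1 / 2 :: real"], of C] by (simp add: power_divide mult.commute)
  have finite: "sum g B \<le> 2 * C" if "finite B" "B \<subseteq> A" for B
  proof -
    have "sum g B \<le> (\<Sum>i\<in>B. C / 2 ^ i)"
      using assms that by (intro sum_mono) auto
    also have "\<dots> \<le> (\<Sum>i. C / 2 ^ i)"
      using geo assms(3) that by (intro sum_le_suminf) (auto simp: sums_iff)
    finally show ?thesis
      using geo by (simp add: sums_iff)
  qed
  show "g summable_on A"
    using assms(1) finite by (intro nonneg_bdd_above_summable_on bdd_aboveI[of _ "2 * C"]) auto
  then show "infsum g A \<le> 2 * C"
    using finite by (rule infsum_le_finite_sums)
qed

section \<open>Error estimates along the chosen subsequence\<close>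

theorem theorem4p1:
  fixes \<alpha> :: countable_ordinal
    and f :: "'a::metric_space \<Rightarrow> complex"
    and F :: "nat \<Rightarrow> 'a \<Rightarrow> complex"
    and x :: 'a
    and lambda \<eta> :: real
  assumes "1 \<le> \<alpha>"
    and "separable_space (euclidean :: 'a topology)"
    and "\<And>j. 1 \<le> j \<Longrightarrow> continuous_on UNIV (F j)"
    and "\<exists>C. \<forall>j\<ge>1. \<forall>t. cmod (F j t) \<le> C"
    and "\<And>t. (\<lambda>j. F j t) \<longlonglongrightarrow> f t"
    and "pos_osc (\<lambda>t. Re (f t)) \<alpha> x = ereal lambda"
    and "0 < lambda"
    and "0 < \<eta>" and "\<eta> < 1"
  shows "\<exists>s. strict_mono_on {1..} s \<and> s ` {1..} \<subseteq> {1..} \<and>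
    (let e = difference_sequence (\<lambda>j. F (s j)) in
      \<forall>m :: nat \<Rightarrow> nat. m 1 = 1 \<and> strict_mono_on {1..} m \<longrightarrow>
        (\<exists>t k. 1 \<le> k \<and>
          (\<Sum>j=1..k. Re (e (m (2 * j)) t)) > (1 - \<eta>) * lambda \<and>
          (\<forall>j\<in>{1..k}. Re (e (m (2 * j)) t) > 0) \<and>
          (\<lambda>i. cmod (e i t)) summable_on ({1..} - m ` {1..}) \<and>
          (\<Sum>\<^sub>\<infinity>i\<in>{1..} - m ` {1..}. cmod (e i t)) < \<eta> * lambda))"
proof -
  define \<phi> where "\<phi> = (\<lambda>t. Re (f t))"
  \<comment> \<open>Half of the allowance \<open>\<eta> * lambda\<close> goes into
    \<open>r < lambda\<close>; each of the two error sums is at most \<open>6 * E\<close>, less than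
    the other half.\<close>
  define r where "r = (1 - \<eta> / 2) * lambda"
  define E where "E = \<eta> * lambda / 16"
  \<comment> \<open>Invalid states count as terminal so that every state outside \<open>T\<close>
    can move. A run from \<open>s0\<close> stays valid, so it ends at a jump with negative
    target.\<close>
  define T where "T = {s. \<not> valid \<phi> s \<or> \<not> is_Base s \<and> target s < 0}"
  have "0 < \<eta> * lambda"
    using assms by simp
  then have "0 < E" "r < lambda" "0 \<le> r"
    using assms by (auto simp: E_def r_def algebra_simps)
  then obtain y \<beta> c where "0 < c" "rises \<phi> y r \<beta> c"
    using pos_osc_descent[of r \<phi> \<alpha> x UNIV] assms(6) by (auto simp: \<phi>_def)
  define s0 where "s0 = Base y r \<beta> c"
  have s0: "valid \<phi> s0" "is_Base s0" "target s0 = r"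
    using \<open>0 < c\<close> \<open>rises \<phi> y r \<beta> c\<close> by (auto simp: s0_def)
  \<comment> \<open>With \<open>gap / 2\<close> as tolerance, the errors at the two ends of a rise
    total at most the gap, which the rise strictly exceeds; so the difference stays
    positive.\<close>
  let ?close = "\<lambda>\<sigma> m n st. \<forall>i\<in>{1..n}. \<forall>j\<ge>m i. (i < n \<longrightarrow> j < m (Suc i)) \<longrightarrow>
    dist (F (\<sigma> j) (point (st n))) (f (point (st i))) \<le> min (E / 2 ^ j) (gap (st i) / 2)"
  have "\<exists>\<sigma>. strict_mono \<sigma> \<and> (\<forall>j. 1 \<le> \<sigma> j) \<and>
    (\<forall>m. strict_mono_on {1..} m \<and> 1 \<le> m 1 \<longrightarrow>
      (\<exists>n st. 1 \<le> n \<and> st 1 = s0 \<and> st n \<in> T \<and>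
        (\<forall>i\<in>{1..<n}. climb \<phi> (st i) (st (Suc i))) \<and> ?close \<sigma> m n st))"
  proof (rule approximating_subsequence)
    show "0 < gap s0 / 2"
      using s0 valid_gap_pos by auto
    show "0 < gap s' / 2" if "climb \<phi> s s'" for s s'
      using that climb_valid valid_gap_pos by fastforce
    show "\<exists>s'. climb \<phi> s s' \<and> point s' \<in> W" if "s \<notin> T" "open W" "point s \<in> W" for s W
      using that by (intro climb_progress) (auto simp: T_def)
  qed (fact assms(3) assms(5) wf_climb \<open>0 < E\<close>)+
  then obtain \<sigma> where \<sigma>: "strict_mono \<sigma>" "\<forall>j. 1 \<le> \<sigma> j"
    and play: "\<forall>m. strict_mono_on {1..} m \<and> 1 \<le> m 1 \<longrightarrow>
      (\<exists>n st. 1 \<le> n \<and> st 1 = s0 \<and> st n \<in> T \<and>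
        (\<forall>i\<in>{1..<n}. climb \<phi> (st i) (st (Suc i))) \<and> ?close \<sigma> m n st)"
    by (elim exE conjE) (rule that)
  define e where "e = difference_sequence (\<lambda>j. F (\<sigma> j))"
  have e: "e i t = F (\<sigma> i) t - F (\<sigma> (i - 1)) t" if "i \<noteq> 1" for i t
    using that by (simp add: e_def difference_sequence_def)
  have "\<exists>t k. 1 \<le> k \<and> (\<Sum>j=1..k. Re (e (m (2 * j)) t)) > (1 - \<eta>) * lambda \<and>
      (\<forall>j\<in>{1..k}. Re (e (m (2 * j)) t) > 0) \<and>
      (\<lambda>i. cmod (e i t)) summable_on ({1..} - m ` {1..}) \<and>
      (\<Sum>\<^sub>\<infinity>i\<in>{1..} - m ` {1..}. cmod (e i t)) < \<eta> * lambda"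
    if m: "m 1 = 1" "strict_mono_on {1..} m" for m :: "nat \<Rightarrow> nat"
  proof -
    from play[rule_format, of m] m
    obtain n st where n: "1 \<le> n" "st 1 = s0" "st n \<in> T"
      and chain: "\<forall>i\<in>{1..<n}. climb \<phi> (st i) (st (Suc i))" and close: "?close \<sigma> m n st"
      by (elim exE conjE meta_impE) simp_all
    note chain = bspec[OF chain]
    have near: "dist (F (\<sigma> j) (point (st n))) (f (point (st i))) \<le> min (E / 2 ^ j) (gap (st i) / 2)"
      if "i \<in> {1..n}" "m i \<le> j" "i < n \<Longrightarrow> j < m (Suc i)" for i j
      using close that by blast
    define t where "t = point (st n)"
    note parity = climb_chain[of \<phi> st n, OF _ _ chain, unfolded n(2), OF s0(1,2), THEN conjunct2]
    have "valid \<phi> (st n)"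
      using climb_chain[of \<phi> st n n, OF _ _ chain] n s0 by simp
    then have "even n" "target (st n) < 0"
      using n parity[of n] by (auto simp: T_def)
    then obtain k where k: "n = 2 * k" "1 \<le> k"
      using n(1) by (auto elim!: evenE)
    define D where "D j = \<phi> (point (st (2 * j))) - \<phi> (point (st (2 * j - 1)))" for j
    have "target (st n) = r - sum D {1..k}"
      using climb_chain_target[of st n \<phi> k, OF _ chain _ _ parity] k n s0
      by (simp add: D_def)
    with \<open>target (st n) < 0\<close> have D_sum: "r < sum D {1..k}"
      by simp
    have rise: "0 < Re (e (m (2 * j)) t)" "D j - 3 * E / 2 ^ j \<le> Re (e (m (2 * j)) t)"
      if j: "j \<in> {1..k}" for j
    proof -
      define i where "i = 2 * j - 1"
      have i: "1 \<le> i" "Suc i = 2 * j" "i < n" "odd i"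
        using j k by (auto simp: i_def)
      have step: "climb \<phi> (st i) (st (2 * j))" "is_Base (st i)"
        using chain[of i] parity[of i] i by auto
      have mono: "m i < m (2 * j)" "m (2 * j) < m (Suc (2 * j))"
        using m i by (auto simp: strict_mono_on_def)
      then have before: "dist (F (\<sigma> (m (2 * j) - 1)) t) (f (point (st i)))
          \<le> min (E / 2 ^ (m (2 * j) - 1)) (gap (st i) / 2)"
        unfolding t_def using near[of i "m (2 * j) - 1"] i by auto
      have after: "dist (F (\<sigma> (m (2 * j))) t) (f (point (st (2 * j))))
          \<le> min (E / 2 ^ m (2 * j)) (gap (st i) / 2)"
        unfolding t_def using near[of "2 * j" "m (2 * j)"] climb_Base(1)[OF step] mono k j by auto
      \<comment> \<open>Hence \<open>j \<le> m (2 * j) - 1\<close>, and both errors are at most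
        \<open>E / 2 ^ j\<close>, whatever \<open>m\<close> is.\<close>
      have "2 * j \<le> m (2 * j)"
        using strict_mono_on_ge_self[OF m(2)] m(1) j by simp
      then have "E / 2 ^ m (2 * j) \<le> E / 2 ^ j" "E / 2 ^ (m (2 * j) - 1) \<le> E / 2 ^ j"
        using \<open>0 < E\<close> j by (auto intro!: divide_left_mono power_increasing)
      moreover have "0 < E / 2 ^ j"
        using \<open>0 < E\<close> by simp
      moreover have "Re (e (m (2 * j)) t) = Re (F (\<sigma> (m (2 * j))) t) - Re (F (\<sigma> (m (2 * j) - 1)) t)"
        using \<open>2 * j \<le> m (2 * j)\<close> j by (subst e) auto
      moreover have "\<bar>Re (F (\<sigma> (m (2 * j))) t) - \<phi> (point (st (2 * j)))\<bar>
          \<le> dist (F (\<sigma> (m (2 * j))) t) (f (point (st (2 * j))))"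
        using abs_Re_le_cmod[of "F (\<sigma> (m (2 * j))) t - f (point (st (2 * j)))"]
        by (simp add: \<phi>_def dist_norm)
      moreover have "\<bar>Re (F (\<sigma> (m (2 * j) - 1)) t) - \<phi> (point (st i))\<bar>
          \<le> dist (F (\<sigma> (m (2 * j) - 1)) t) (f (point (st i)))"
        using abs_Re_le_cmod[of "F (\<sigma> (m (2 * j) - 1)) t - f (point (st i))"]
        by (simp add: \<phi>_def dist_norm)
      moreover have "D j = \<phi> (point (st (2 * j))) - \<phi> (point (st i))" "gap (st i) < D j"
        using climb_Base(2)[OF step] by (auto simp: D_def i_def)
      moreover have "3 * E / 2 ^ j = E / 2 ^ j + E / 2 ^ j + E / 2 ^ j"
        by simp
      ultimately show "0 < Re (e (m (2 * j)) t)" "D j - 3 * E / 2 ^ j \<le> Re (e (m (2 * j)) t)"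
        using before after by linarith+
    qed
    have "(\<Sum>j=1..k. 3 * E / 2 ^ j) \<le> 6 * E"
      using infsum_geometric_bound(2)[of "{1..k}" "\<lambda>j. 3 * E / 2 ^ j" "3 * E"] \<open>0 < E\<close> by simp
    then have "(1 - \<eta>) * lambda < sum D {1..k} - (\<Sum>j=1..k. 3 * E / 2 ^ j)"
      using D_sum \<open>0 < \<eta> * lambda\<close> by (simp add: E_def r_def algebra_simps)
    also have "\<dots> = (\<Sum>j=1..k. D j - 3 * E / 2 ^ j)"
      by (simp add: sum_subtractf)
    also have "\<dots> \<le> (\<Sum>j=1..k. Re (e (m (2 * j)) t))"
      using rise by (intro sum_mono) auto
    finally have large: "(1 - \<eta>) * lambda < (\<Sum>j=1..k. Re (e (m (2 * j)) t))" .
    \<comment> \<open>The same state is current at \<open>i - 1\<close> and \<open>i\<close>, so the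
      errors add up to \<open>E / 2 ^ i + 2 * (E / 2 ^ i)\<close>. As \<open>m 1 = 1\<close>, the
      exceptional term \<open>e 1\<close> does not occur.\<close>
    have small: "cmod (e i t) \<le> 3 * E / 2 ^ i" if i: "i \<in> {1..} - m ` {1..}" for i
    proof -
      obtain l where l: "l \<in> {1..n}" "m l \<le> i" "l < n \<longrightarrow> i < m (Suc l)"
        using segment_exists[OF n(1), of m i] m(1) i by (metis DiffD1 atLeast_iff)
      have "m l \<in> m ` {1..}" "m 1 \<in> m ` {1..}"
        using l(1) by auto
      then have "m l \<noteq> i" "1 \<noteq> i"
        using i m(1) by (metis DiffD2)+
      with l have "m l \<le> i - 1"
        by simp
      then have "dist (F (\<sigma> i) t) (f (point (st l))) \<le> E / 2 ^ i"
        "dist (F (\<sigma> (i - 1)) t) (f (point (st l))) \<le> E / 2 ^ (i - 1)"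
        unfolding t_def using near[of l i] near[of l "i - 1"] l by auto
      moreover have "E / 2 ^ (i - 1) = 2 * (E / 2 ^ i)"
        using i by (cases i) auto
      moreover have "cmod (e i t) = dist (F (\<sigma> i) t) (F (\<sigma> (i - 1)) t)"
        using \<open>1 \<noteq> i\<close> by (simp add: e dist_norm)
      ultimately show ?thesis
        using dist_triangle2[of "F (\<sigma> i) t" "F (\<sigma> (i - 1)) t" "f (point (st l))"] by simp
    qed
    have "(\<lambda>i. cmod (e i t)) summable_on ({1..} - m ` {1..})"
      "(\<Sum>\<^sub>\<infinity>i\<in>{1..} - m ` {1..}. cmod (e i t)) \<le> 6 * E"
      using infsum_geometric_bound[of "{1..} - m ` {1..}" "\<lambda>i. cmod (e i t)" "3 * E"]
        small \<open>0 < E\<close> by auto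
    moreover have "6 * E < \<eta> * lambda"
      using \<open>0 < \<eta> * lambda\<close> by (simp add: E_def)
    ultimately show ?thesis
      using large rise(1) k(2) by (intro exI[of _ t] exI[of _ k] conjI) auto
  qed
  then show ?thesis
    using \<sigma> unfolding e_def Let_def
    by (intro exI[of _ \<sigma>] conjI) (auto simp: strict_mono_def strict_mono_on_def)
qed

end
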